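(* Let $$\mu_1=\frac{1+z^2+\sqrt{1-10z^2+9z^4}}{2z},\qquad \mu_2=\frac{1+z^2-\sqrt{1-10z^2+9z^4}}{2z}.$$ For every integer $i\ge0$, the generating functions $f_i,g_i,h_i$ of skew Dyck paths (or prefixes of them) with two variants of down-steps leading to level $i$ (classified by the type of the last step, see context) are given by $$f_i=\frac1{\mu_1^i},\qquad g_i=\frac1{z\mu_1^{i+1}}-\frac1{\mu_1^{i}},\qquad h_i=-\frac12\,\frac1{\mu_1^i}-\Bigl(z-\frac1{2z}\Bigr)\frac1{\mu_1^{i+1}}.$$ These may be rewritten using $\mu_2=\dfrac{3-2z^2}{\mu_1}$. The total generating function leading to level $i$ is $$f_i+g_i+h_i=-\frac12\,\frac1{\mu_1^i}-\Bigl(z-\frac3{2z}\Bigr)\frac1{\mu_1^{i+1}}.$$ In particular, $$f_0+g_0+h_0=\frac{1-z^2-\sqrt{1-10z^2+9z^4}}{4z^2}.$$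
   Context: Consider finite words over the alphabet $\{U,D_g,D_b,D_r\}$. The step $U$ is an up-step $(1,1)$. The steps $D_g$ (green) and $D_b$ (blue) are two differently coloured down-steps $(1,-1)$. The step $D_r$ (red) represents the left step $L=(-1,-1)$ of a skew Dyck path and is drawn as a red down-step $(1,-1)$. A path starts at level $0$; each $U$ raises the level by $1$ and each of $D_g,D_b,D_r$ lowers it by $1$. A prefix of a skew Dyck path with two variants of down-steps is such a word that never goes below level $0$ and in which the consecutive patterns $UD_r$ and $D_rU$ do not occur. It is a skew Dyck path with two variants of down-steps if in addition it ends at level $0$. The empty word is allowed. The variable $z$ marks the length (total number of steps). For $i\ge 0$ let $f_i=f_i(z)$, $g_i=g_i(z)$, $h_i=h_i(z)$ be the generating functions of those prefixes ending at level $i$ that, respectively, are empty or have last step $U$ (for $f_i$), have last step $D_g$ or $D_b$ (for $g_i$), or have last step $D_r$ (for $h_i$). Equivalently, they are the formal power series in $z$ satisfying, for $i\ge0$, $f_0=1$, $f_{i+1}=zf_i+zg_i$, $g_i=2zf_{i+1}+2zg_{i+1}+2zh_{i+1}$, $h_i=zg_{i+1}+zh_{i+1}$. Identities are understood as identities of formal Laurent series in $z$, where $\sqrt{1-10z^2+9z^4}$ is the power series square root with constant term $1$ (so $1/\mu_1$ is a power series in $z$ with zero constant term). *)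

theory Defs
  imports
    "HOL-Library.Sublist"
    "HOL-Computational_Algebra.Formal_Laurent_Series"
    Complex_Main
begin

(* Dn_r encodes the left step (-1,-1), drawn as a red down-step (1,-1). *)
datatype step = Up | Dn_g | Dn_b | Dn_r

fun rise :: "step \<Rightarrow> int" where
  "rise Up = 1"
| "rise Dn_g = -1"
| "rise Dn_b = -1"
| "rise Dn_r = -1"

definition level :: "step list \<Rightarrow> int" where
  "level w = sum_list (map rise w)"

(* sublist is the contiguous factor relation, prefix the initial-segment relation on words. *)
definition skew_prefix :: "step list \<Rightarrow> bool" where
  "skew_prefix w \<longleftrightarrow>
     (\<forall>u. prefix u w \<longrightarrow> 0 \<le> level u) \<and>
     \<not> sublist [Up, Dn_r] w \<and> \<not> sublist [Dn_r, Up] w"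

(* There are only finitely many words of each length, so card is a genuine count here. *)
definition gf_level :: "(step list \<Rightarrow> bool) \<Rightarrow> nat \<Rightarrow> real fls" where
  "gf_level P i = fps_to_fls (Abs_fps (\<lambda>n.
     of_nat (card {w. skew_prefix w \<and> length w = n \<and> level w = int i \<and> P w})))"

definition gf_f :: "nat \<Rightarrow> real fls" where
  "gf_f = gf_level (\<lambda>w. w = [] \<or> last w = Up)"

definition gf_g :: "nat \<Rightarrow> real fls" where
  "gf_g = gf_level (\<lambda>w. w \<noteq> [] \<and> (last w = Dn_g \<or> last w = Dn_b))"

definition gf_h :: "nat \<Rightarrow> real fls" where
  "gf_h = gf_level (\<lambda>w. w \<noteq> [] \<and> last w = Dn_r)"

definition gf_total :: "nat \<Rightarrow> real fls" where
  "gf_total = gf_level (\<lambda>w. True)"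

abbreviation z :: "real fls" where
  "z \<equiv> fls_X"

definition sqrt_disc_fps :: "real fps" where
  "sqrt_disc_fps = fps_radical root 2 (1 - 10 * fps_X ^ 2 + 9 * fps_X ^ 4)"

(* The two properties that determine the power series square root. *)
lemma sqrt_disc_fps_nth_0: "fps_nth sqrt_disc_fps 0 = 1"
  by (simp add: sqrt_disc_fps_def numeral_2_eq_2 fps_mult_nth_0 del: One_nat_def)

lemma sqrt_disc_fps_square: "sqrt_disc_fps ^ 2 = 1 - 10 * fps_X ^ 2 + 9 * fps_X ^ 4"
proof -
  let ?a = "1 - 10 * fps_X ^ 2 + 9 * fps_X ^ 4 :: real fps"
  have "fps_nth ?a 0 = 1"
    by simp
  then have "fps_radical root (Suc 1) ?a ^ Suc 1 = ?a"
    by (subst power_radical[symmetric]) auto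
  then show ?thesis
    by (simp only: sqrt_disc_fps_def Suc_1)
qed

definition sqrt_disc :: "real fls" where
  "sqrt_disc = fps_to_fls sqrt_disc_fps"

definition \<mu>\<^sub>1 :: "real fls" where
  "\<mu>\<^sub>1 = (1 + z ^ 2 + sqrt_disc) / (2 * z)"

definition \<mu>\<^sub>2 :: "real fls" where
  "\<mu>\<^sub>2 = (1 + z ^ 2 - sqrt_disc) / (2 * z)"

end

(* Removing the last step turns the three path classes into a linear system, which
   determines f, g, h coefficient by coefficient. So it suffices that the claimed closed forms solve
   the system. With W = 1 / (z mu_1) they are f_i = (z W)^i, g_i = (W - 1) (z W)^i and
   h_i = (W - 1 - 2 z^2 W) / 2 * (z W)^i, all power series in z, and the system then reduces to
   the quadratic equation W = 1 - z^2 W + z^2 (3 - 2 z^2) W^2. *)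
theory Submission
  imports Defs
begin

section \<open>Counting words by length, level and last step\<close>

definition skew_words :: "(step list \<Rightarrow> bool) \<Rightarrow> nat \<Rightarrow> int \<Rightarrow> step list set" where
  "skew_words P n j = {w. skew_prefix w \<and> length w = n \<and> level w = j \<and> P w}"

definition gf_fps :: "(step list \<Rightarrow> bool) \<Rightarrow> nat \<Rightarrow> real fps" where
  "gf_fps P i = Abs_fps (\<lambda>n. of_nat (card (skew_words P n (int i))))"

lemma gf_level_eq: "gf_level P i = fps_to_fls (gf_fps P i)"
  by (simp add: gf_level_def gf_fps_def skew_words_def)

text \<open>Forbidden factors have length two, so a new one can only arise across the junction of
  \<open>u\<close> and \<open>s\<close>. The level condition is kept apart, because prescribing a
  final level \<open>0 \<le> j\<close> already guarantees it.\<close>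

definition can_append :: "step \<Rightarrow> step list \<Rightarrow> bool" where
  "can_append s u \<longleftrightarrow>
     \<not> (u \<noteq> [] \<and> last u = Up \<and> s = Dn_r) \<and> \<not> (u \<noteq> [] \<and> last u = Dn_r \<and> s = Up)"

lemma UNIV_step: "(UNIV :: step set) = {Up, Dn_g, Dn_b, Dn_r}"
  using step.exhaust by blast

lemma finite_skew_words: "finite (skew_words P n j)"
proof -
  have "finite {w :: step list. set w \<subseteq> UNIV \<and> length w = n}"
    by (rule finite_lists_length_eq) (simp add: UNIV_step)
  then show ?thesis
    by (rule rev_finite_subset) (auto simp: skew_words_def)
qed

lemma level_simps [simp]: "level [] = 0" "level (u @ [s]) = level u + rise s"
  by (simp_all add: level_def)

lemma skew_prefix_Nil: "skew_prefix []"
  by (simp add: skew_prefix_def)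

text \<open>A factor of \<open>u @ [s]\<close> either lies within \<open>u\<close> or is a suffix of
  the whole word.\<close>

lemma sublist_pair_snoc:
  "sublist [a, b] (u @ [s]) \<longleftrightarrow> sublist [a, b] u \<or> (u \<noteq> [] \<and> last u = a \<and> s = b)"
proof -
  have "suffix [a, b] (u @ [s]) \<longleftrightarrow> u \<noteq> [] \<and> last u = a \<and> s = b"
    by (cases u rule: rev_cases) (auto simp: suffix_def)
  then show ?thesis
    by (auto simp: sublist_snoc)
qed

lemma skew_prefix_snoc:
  "skew_prefix (u @ [s]) \<longleftrightarrow> skew_prefix u \<and> 0 \<le> level u + rise s \<and> can_append s u"
  by (auto simp: skew_prefix_def can_append_def sublist_pair_snoc)

text \<open>Deleting the last step is a bijection. In the reverse direction,
  \<open>0 \<le> j\<close> ensures that the appended step does not leave the nonnegative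
  levels.\<close>

lemma card_skew_words_snoc:
  assumes "0 \<le> j"
  shows "card (skew_words (\<lambda>w. w \<noteq> [] \<and> last w = s) (Suc n) j)
       = card (skew_words (can_append s) n (j - rise s))"
proof -
  have "skew_words (\<lambda>w. w \<noteq> [] \<and> last w = s) (Suc n) j
      = (\<lambda>u. u @ [s]) ` skew_words (can_append s) n (j - rise s)" (is "?A = ?B")
  proof
    show "?A \<subseteq> ?B"
    proof
      fix w assume w: "w \<in> ?A"
      then obtain u where "w = u @ [s]"
        by (cases w rule: rev_cases) (auto simp: skew_words_def)
      with w show "w \<in> ?B"
        by (auto simp: skew_words_def skew_prefix_snoc)
    qed
    show "?B \<subseteq> ?A"
      using assms by (auto simp: skew_words_def skew_prefix_snoc)
  qed
  then show ?thesis
    by (simp add: card_image inj_on_def)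
qed

lemma level_nonneg: "skew_prefix w \<Longrightarrow> 0 \<le> level w"
  by (simp add: skew_prefix_def)

text \<open>Covers up-steps ending at level 0: they would have to start from level -1.\<close>

lemma skew_words_neg: "j < 0 \<Longrightarrow> skew_words P n j = {}"
  using level_nonneg by (fastforce simp: skew_words_def)

lemma gf_fps_disj:
  assumes "\<And>w. \<not> (P w \<and> Q w)"
  shows "gf_fps (\<lambda>w. P w \<or> Q w) i = gf_fps P i + gf_fps Q i"
proof (rule fps_ext)
  fix n
  have "skew_words (\<lambda>w. P w \<or> Q w) n (int i) = skew_words P n (int i) \<union> skew_words Q n (int i)"
    by (auto simp: skew_words_def)
  moreover have "skew_words P n (int i) \<inter> skew_words Q n (int i) = {}"
    using assms by (auto simp: skew_words_def)
  ultimately show "gf_fps (\<lambda>w. P w \<or> Q w) i $ n = (gf_fps P i + gf_fps Q i) $ n"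
    by (simp add: gf_fps_def card_Un_disjoint finite_skew_words)
qed

lemma gf_fps_cong:
  assumes "\<And>w. skew_prefix w \<Longrightarrow> level w = int i \<Longrightarrow> P w \<longleftrightarrow> Q w"
  shows "gf_fps P i = gf_fps Q i"
proof -
  have "skew_words P n (int i) = skew_words Q n (int i)" for n
    using assms by (auto simp: skew_words_def)
  then show ?thesis by (simp add: gf_fps_def)
qed

lemma gf_fps_Nil: "gf_fps (\<lambda>w. w = []) i = (if i = 0 then 1 else 0)"
proof (rule fps_ext)
  fix n
  have "skew_words (\<lambda>w. w = []) n (int i) = (if n = 0 \<and> i = 0 then {[]} else {})"
    by (auto simp: skew_words_def skew_prefix_Nil)
  then show "gf_fps (\<lambda>w. w = []) i $ n = (if i = 0 then 1 else 0 :: real fps) $ n"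
    by (simp add: gf_fps_def)
qed

text \<open>The factor \<open>fps_X\<close> pays for the deleted step; the constant coefficient
  vanishes because the empty word is excluded.\<close>

lemma gf_fps_last_down:
  assumes "rise s = - 1"
  shows "gf_fps (\<lambda>w. w \<noteq> [] \<and> last w = s) i = fps_X * gf_fps (can_append s) (Suc i)"
proof (rule fps_ext)
  fix n
  show "gf_fps (\<lambda>w. w \<noteq> [] \<and> last w = s) i $ n = (fps_X * gf_fps (can_append s) (Suc i)) $ n"
  proof (cases n)
    case 0
    then show ?thesis by (auto simp: gf_fps_def skew_words_def)
  next
    case (Suc m)
    then show ?thesis
      by (simp add: gf_fps_def card_skew_words_snoc assms add.commute)
  qed
qed

lemma gf_fps_last_Up:
  "gf_fps (\<lambda>w. w \<noteq> [] \<and> last w = Up) i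
     = (case i of 0 \<Rightarrow> 0 | Suc k \<Rightarrow> fps_X * gf_fps (can_append Up) k)"
proof (rule fps_ext)
  fix n
  show "gf_fps (\<lambda>w. w \<noteq> [] \<and> last w = Up) i $ n
      = (case i of 0 \<Rightarrow> 0 | Suc k \<Rightarrow> fps_X * gf_fps (can_append Up) k) $ n"
  proof (cases n)
    case 0
    then show ?thesis by (auto simp: gf_fps_def skew_words_def split: nat.split)
  next
    case (Suc m)
    then show ?thesis
      by (simp add: gf_fps_def card_skew_words_snoc skew_words_neg split: nat.split)
  qed
qed

section \<open>The three path classes and their linear system\<close>

definition fps_f :: "nat \<Rightarrow> real fps" where
  "fps_f = gf_fps (\<lambda>w. w = [] \<or> last w = Up)"

definition fps_g :: "nat \<Rightarrow> real fps" where
  "fps_g = gf_fps (\<lambda>w. w \<noteq> [] \<and> (last w = Dn_g \<or> last w = Dn_b))"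

definition fps_h :: "nat \<Rightarrow> real fps" where
  "fps_h = gf_fps (\<lambda>w. w \<noteq> [] \<and> last w = Dn_r)"

lemma gf_fps_total: "gf_fps (\<lambda>w. True) i = fps_f i + fps_g i + fps_h i"
proof -
  have "gf_fps (\<lambda>w. True) i
      = gf_fps (\<lambda>w. ((w = [] \<or> last w = Up) \<or> (w \<noteq> [] \<and> (last w = Dn_g \<or> last w = Dn_b)))
                    \<or> (w \<noteq> [] \<and> last w = Dn_r)) i"
    by (rule gf_fps_cong) (use step.exhaust in blast)
  then show ?thesis
    by (subst (asm) gf_fps_disj, force, subst (asm) gf_fps_disj)
      (force simp: fps_f_def fps_g_def fps_h_def)+
qed

text \<open>Only a red last step blocks an up-step; the empty word is counted in
  \<open>fps_f\<close>.\<close>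

lemma gf_fps_can_append_Up: "gf_fps (can_append Up) i = fps_f i + fps_g i"
proof -
  have "gf_fps (can_append Up) i
      = gf_fps (\<lambda>w. (w = [] \<or> last w = Up) \<or> (w \<noteq> [] \<and> (last w = Dn_g \<or> last w = Dn_b))) i"
    by (rule gf_fps_cong, case_tac "last w") (auto simp: can_append_def)
  then show ?thesis
    by (subst (asm) gf_fps_disj) (force simp: fps_f_def fps_g_def)+
qed

text \<open>\<open>can_append Dn_r\<close> admits the empty word, but that word ends at level 0;
  hence the restriction to \<open>Suc i\<close>.\<close>

lemma gf_fps_can_append_Dn_r: "gf_fps (can_append Dn_r) (Suc i) = fps_g (Suc i) + fps_h (Suc i)"
proof -
  have "gf_fps (can_append Dn_r) (Suc i)
      = gf_fps (\<lambda>w. (w \<noteq> [] \<and> (last w = Dn_g \<or> last w = Dn_b)) \<or> (w \<noteq> [] \<and> last w = Dn_r)) (Suc i)"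
    by (rule gf_fps_cong, case_tac "last w") (auto simp: can_append_def)
  then show ?thesis
    by (subst (asm) gf_fps_disj) (force simp: fps_g_def fps_h_def)+
qed

definition skew_system :: "(nat \<Rightarrow> real fps) \<Rightarrow> (nat \<Rightarrow> real fps) \<Rightarrow> (nat \<Rightarrow> real fps) \<Rightarrow> bool" where
  "skew_system f g h \<longleftrightarrow> f 0 = 1
     \<and> (\<forall>i. f (Suc i) = fps_X * (f i + g i))
     \<and> (\<forall>i. g i = fps_X * (2 * (f (Suc i) + g (Suc i) + h (Suc i))))
     \<and> (\<forall>i. h i = fps_X * (g (Suc i) + h (Suc i)))"

lemma skew_system_gf: "skew_system fps_f fps_g fps_h"
proof -
  \<comment> \<open>The empty word contributes 1 at level 0 and nothing elsewhere, which yields the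
    initial condition.\<close>
  have f: "fps_f i = gf_fps (\<lambda>w. w = []) i + gf_fps (\<lambda>w. w \<noteq> [] \<and> last w = Up) i" for i
    unfolding fps_f_def
    by (subst gf_fps_disj[symmetric]) (auto intro: gf_fps_cong)
  have g: "fps_g i = fps_X * (2 * (fps_f (Suc i) + fps_g (Suc i) + fps_h (Suc i)))" for i
  proof -
    have "fps_g i = gf_fps (\<lambda>w. w \<noteq> [] \<and> last w = Dn_g) i + gf_fps (\<lambda>w. w \<noteq> [] \<and> last w = Dn_b) i"
      unfolding fps_g_def
      by (subst gf_fps_disj[symmetric]) (auto intro: gf_fps_cong)
    \<comment> \<open>Green and blue steps may follow anything, so both colours give the same term;
      this is the factor 2 in the system.\<close>
    moreover have "gf_fps (can_append s) k = gf_fps (\<lambda>w. True) k" if "s \<in> {Dn_g, Dn_b}" for s k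
      by (rule gf_fps_cong) (use that in \<open>auto simp: can_append_def\<close>)
    ultimately show ?thesis
      by (simp add: gf_fps_last_down gf_fps_total algebra_simps)
  qed
  have h: "fps_h i = fps_X * (fps_g (Suc i) + fps_h (Suc i))" for i
  proof -
    have "fps_h i = fps_X * gf_fps (can_append Dn_r) (Suc i)"
      unfolding fps_h_def by (rule gf_fps_last_down) simp
    then show ?thesis
      by (simp only: gf_fps_can_append_Dn_r)
  qed
  have "fps_f 0 = 1" "fps_f (Suc i) = fps_X * (fps_f i + fps_g i)" for i
    using f by (simp_all add: gf_fps_Nil gf_fps_last_Up gf_fps_can_append_Up)
  with g h show ?thesis
    unfolding skew_system_def by blast
qed

text \<open>Every unknown on a right-hand side carries a factor \<open>fps_X\<close>, so the system determines
  the coefficients of \<open>X^n\<close>, at all levels at once, by induction on \<open>n\<close>.\<close>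

lemma skew_system_unique:
  assumes "skew_system f g h" "skew_system f' g' h'"
  shows "f i = f' i \<and> g i = g' i \<and> h i = h' i"
proof -
  have f: "f 0 = 1" "f (Suc i) = fps_X * (f i + g i)"
    and f': "f' 0 = 1" "f' (Suc i) = fps_X * (f' i + g' i)"
    and g: "g i = fps_X * (2 * (f (Suc i) + g (Suc i) + h (Suc i)))"
    and g': "g' i = fps_X * (2 * (f' (Suc i) + g' (Suc i) + h' (Suc i)))"
    and h: "h i = fps_X * (g (Suc i) + h (Suc i))"
    and h': "h' i = fps_X * (g' (Suc i) + h' (Suc i))" for i
    using assms unfolding skew_system_def by blast+
  have "f i $ n = f' i $ n \<and> g i $ n = g' i $ n \<and> h i $ n = h' i $ n" for i n
  proof (induction n arbitrary: i)
    case 0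
    have "f i $ 0 = f' i $ 0"
      by (cases i) (simp_all add: f f')
    moreover have "g i $ 0 = g' i $ 0"
      by (subst g, subst g') simp
    moreover have "h i $ 0 = h' i $ 0"
      by (subst h, subst h') simp
    ultimately show ?case by blast
  next
    case (Suc n)
    have "f i $ Suc n = f' i $ Suc n"
      using Suc.IH by (cases i) (simp_all add: f f')
    moreover have "g i $ Suc n = g' i $ Suc n"
      by (subst g, subst g') (simp add: Suc.IH fps_numeral_fps_const)
    moreover have "h i $ Suc n = h' i $ Suc n"
      by (subst h, subst h') (simp add: Suc.IH)
    ultimately show ?case by blast
  qed
  then show ?thesis
    by (simp add: fps_eq_iff)
qed

section \<open>The closed forms as a solution of the system\<close>

text \<open>\<open>recip_z\<mu>\<^sub>1\<close> is \<open>1 / (z * \<mu>\<^sub>1)\<close>, a power series with constant term \<open>1\<close>.\<close>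

definition recip_z\<mu>\<^sub>1 :: "real fps" where
  "recip_z\<mu>\<^sub>1 = 2 * inverse (1 + fps_X ^ 2 + sqrt_disc_fps)"

lemma recip_z\<mu>\<^sub>1_mult: "recip_z\<mu>\<^sub>1 * (1 + fps_X ^ 2 + sqrt_disc_fps) = 2"
  unfolding recip_z\<mu>\<^sub>1_def mult.assoc
  by (subst inverse_mult_eq_1) (simp_all add: sqrt_disc_fps_nth_0)

lemma recip_z\<mu>\<^sub>1_quadratic:
  "recip_z\<mu>\<^sub>1 = 1 - fps_X ^ 2 * recip_z\<mu>\<^sub>1 + fps_X ^ 2 * (3 - 2 * fps_X ^ 2) * recip_z\<mu>\<^sub>1 ^ 2"
proof -
  let ?w = recip_z\<mu>\<^sub>1 and ?X = "fps_X :: real fps"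
  \<comment> \<open>Isolating the root lets squaring eliminate it. The coefficient
    \<open>3 - 2 * ?X ^ 2\<close> arises from (1 + X^2)^2 - (1 - 10 X^2 + 9 X^4) = 4 X^2 (3 - 2
    X^2).\<close>
  have "sqrt_disc_fps * ?w = 2 - (1 + ?X ^ 2) * ?w"
    using recip_z\<mu>\<^sub>1_mult by (simp add: algebra_simps)
  then have "sqrt_disc_fps ^ 2 * ?w ^ 2 = (2 - (1 + ?X ^ 2) * ?w) ^ 2"
    by (metis power_mult_distrib)
  then have "4 * ?w = 4 * (1 - ?X ^ 2 * ?w + ?X ^ 2 * (3 - 2 * ?X ^ 2) * ?w ^ 2)"
    unfolding sqrt_disc_fps_square by algebra
  then show ?thesis
    by (simp only: mult_cancel_left) simp
qed

text \<open>All three sequences are geometric in \<open>i\<close> with the same ratio, so each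
  recurrence is its instance at level 0 multiplied by a power of that ratio.\<close>

lemma skew_system_closed_form:
  "skew_system (\<lambda>i. (fps_X * recip_z\<mu>\<^sub>1) ^ i)
     (\<lambda>i. (recip_z\<mu>\<^sub>1 - 1) * (fps_X * recip_z\<mu>\<^sub>1) ^ i)
     (\<lambda>i. fps_const (1 / 2) * (recip_z\<mu>\<^sub>1 - 1 - 2 * fps_X ^ 2 * recip_z\<mu>\<^sub>1) * (fps_X * recip_z\<mu>\<^sub>1) ^ i)"
proof -
  let ?w = recip_z\<mu>\<^sub>1 and ?X = "fps_X :: real fps"
  define v where "v = ?X * ?w"
  define c :: "real fps" where "c = fps_const (1 / 2)"
  define h where "h = c * (?w - 1 - 2 * ?X ^ 2 * ?w)"
  \<comment> \<open>Power series do not form a field, so one half enters the algebra only through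
    this relation.\<close>
  have c: "2 * c = 1"
    unfolding c_def by (simp add: fps_numeral_fps_const)
  have h: "2 * h = ?w - 1 - 2 * ?X ^ 2 * ?w"
    unfolding h_def using c by algebra
  have g1: "?w - 1 = ?X * (2 * (v + (?w - 1) * v + h * v))"
    unfolding v_def using h recip_z\<mu>\<^sub>1_quadratic by algebra
  \<comment> \<open>Proved in doubled form to avoid the half, then cancelled in the integral domain
    of power series.\<close>
  have "2 * h = 2 * (?X * ((?w - 1) * v + h * v))"
    unfolding v_def using h recip_z\<mu>\<^sub>1_quadratic by algebra
  then have h1: "h = ?X * ((?w - 1) * v + h * v)"
    by (simp only: mult_cancel_left) simp
  have g: "(?w - 1) * v ^ i = ?X * (2 * (v ^ Suc i + (?w - 1) * v ^ Suc i + h * v ^ Suc i))" for i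
    by (subst g1) (simp add: algebra_simps)
  have h: "h * v ^ i = ?X * ((?w - 1) * v ^ Suc i + h * v ^ Suc i)" for i
    by (subst h1) (simp add: algebra_simps)
  have f: "v ^ Suc i = ?X * (v ^ i + (?w - 1) * v ^ i)" for i
    by (simp add: v_def algebra_simps)
  show ?thesis
    unfolding skew_system_def v_def[symmetric] c_def[symmetric] h_def[symmetric]
    using f g h power_0 by blast
qed

section \<open>Transfer to Laurent series in terms of \<open>\<mu>\<^sub>1\<close>\<close>

theorem theorem2:
  fixes i :: nat
  shows "gf_f i = 1 / \<mu>\<^sub>1 ^ i
    \<and> gf_g i = 1 / (z * \<mu>\<^sub>1 ^ (i + 1)) - 1 / \<mu>\<^sub>1 ^ i
    \<and> gf_h i = - (1 / 2) * (1 / \<mu>\<^sub>1 ^ i) - (z - 1 / (2 * z)) * (1 / \<mu>\<^sub>1 ^ (i + 1))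
    \<and> \<mu>\<^sub>2 = (3 - 2 * z ^ 2) / \<mu>\<^sub>1
    \<and> gf_total i = gf_f i + gf_g i + gf_h i
    \<and> gf_f i + gf_g i + gf_h i
        = - (1 / 2) * (1 / \<mu>\<^sub>1 ^ i) - (z - 3 / (2 * z)) * (1 / \<mu>\<^sub>1 ^ (i + 1))
    \<and> gf_f 0 + gf_g 0 + gf_h 0 = (1 - z ^ 2 - sqrt_disc) / (4 * z ^ 2)"
proof -
  \<comment> \<open>Division by \<open>z\<close> should remain a fraction rather than become a
    shift, so that the field identities below apply.\<close>
  note fls_divide_X [simp del] fls_divide_X_power [simp del]
  define w where "w = fps_to_fls recip_z\<mu>\<^sub>1"
  have to_fls: "fps_to_fls fps_X = z" "fps_to_fls (a * b) = fps_to_fls a * fps_to_fls b"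
    for a b :: "real fps"
    by (simp_all add: fls_times_fps_to_fls)
  have w_mult: "w * (1 + z ^ 2 + sqrt_disc) = 2"
    using arg_cong[OF recip_z\<mu>\<^sub>1_mult, of fps_to_fls]
    by (simp add: w_def sqrt_disc_def to_fls fps_to_fls_power)
  have quad: "w = 1 - z ^ 2 * w + z ^ 2 * (3 - 2 * z ^ 2) * w ^ 2"
    using arg_cong[OF recip_z\<mu>\<^sub>1_quadratic, of fps_to_fls]
    by (simp add: w_def to_fls fps_to_fls_power)
  have w0: "w \<noteq> 0"
    using w_mult by auto
  have "1 + z ^ 2 + sqrt_disc = 2 / w"
    using w_mult w0 by (simp add: field_simps)
  \<comment> \<open>With the root expressed rationally in \<open>w\<close> and \<open>z\<close>, the
    remaining claims become rational identities modulo \<open>quad\<close>.\<close>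
  then have sqrt_disc: "sqrt_disc = 2 / w - 1 - z ^ 2"
    by (simp add: algebra_simps)
  have \<mu>1: "\<mu>\<^sub>1 = 1 / (z * w)"
    unfolding \<mu>\<^sub>1_def sqrt_disc using w0 by (simp add: field_simps)
  have half: "fls_const (1 / 2) = (1 / 2 :: real fls)"
  proof -
    have "2 * fps_const (1 / 2) = (1 :: real fps)"
      by (simp add: fps_numeral_fps_const)
    from arg_cong[OF this, of fps_to_fls] show ?thesis
      by (simp add: to_fls field_simps)
  qed
  have f: "gf_f i = (z * w) ^ i"
    and g: "gf_g i = (w - 1) * (z * w) ^ i"
    and h: "gf_h i = 1 / 2 * (w - 1 - 2 * z ^ 2 * w) * (z * w) ^ i" for i
    using skew_system_unique[OF skew_system_gf skew_system_closed_form, of i]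
    by (simp_all add: gf_f_def gf_g_def gf_h_def gf_level_eq w_def to_fls half fps_to_fls_power
        fps_f_def[symmetric] fps_g_def[symmetric] fps_h_def[symmetric])
  have total: "gf_total i = gf_f i + gf_g i + gf_h i"
    by (simp add: gf_total_def gf_f_def gf_g_def gf_h_def gf_level_eq gf_fps_total
        fps_f_def fps_g_def fps_h_def)
  have \<mu>1_pow: "1 / \<mu>\<^sub>1 ^ k = (z * w) ^ k" for k
    by (simp add: \<mu>1 power_one_over)
  have f': "gf_f i = 1 / \<mu>\<^sub>1 ^ i"
    by (simp only: f \<mu>1_pow)
  have "1 / (z * \<mu>\<^sub>1 ^ (i + 1)) = (1 / \<mu>\<^sub>1 ^ (i + 1)) / z"
    by (simp only: divide_divide_eq_left mult.commute)
  also have "\<dots> = w * (z * w) ^ i"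
    unfolding \<mu>1_pow by (simp add: field_simps)
  finally have g': "gf_g i = 1 / (z * \<mu>\<^sub>1 ^ (i + 1)) - 1 / \<mu>\<^sub>1 ^ i"
    by (simp only: g \<mu>1_pow left_diff_distrib mult_1)
  have h': "gf_h i = - (1 / 2) * (1 / \<mu>\<^sub>1 ^ i) - (z - 1 / (2 * z)) * (1 / \<mu>\<^sub>1 ^ (i + 1))"
    unfolding h \<mu>1_pow by (simp add: field_simps power2_eq_square)
  have \<mu>2: "\<mu>\<^sub>2 = (3 - 2 * z ^ 2) / \<mu>\<^sub>1"
  proof -
    have "\<mu>\<^sub>2 = (1 + z ^ 2 - 1 / w) / z"
      unfolding \<mu>\<^sub>2_def sqrt_disc by (simp add: field_simps)
    also have "\<dots> = (3 - 2 * z ^ 2) * (z * w)"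
    proof -
      \<comment> \<open>This is \<open>quad\<close> rearranged; dividing by \<open>z * w\<close>
        gives the required value of \<open>\<mu>\<^sub>2\<close>.\<close>
      have "(1 + z ^ 2) * w - 1 = (3 - 2 * z ^ 2) * (z * w) * z * w"
        using quad by algebra
      then show ?thesis
        using w0 by (simp add: field_simps)
    qed
    finally show ?thesis
      by (simp add: \<mu>1)
  qed
  have sum': "gf_f i + gf_g i + gf_h i
      = - (1 / 2) * (1 / \<mu>\<^sub>1 ^ i) - (z - 3 / (2 * z)) * (1 / \<mu>\<^sub>1 ^ (i + 1))"
    unfolding f g h \<mu>1_pow by (simp add: field_simps power2_eq_square)
  have zero: "gf_f 0 + gf_g 0 + gf_h 0 = (1 - z ^ 2 - sqrt_disc) / (4 * z ^ 2)"
  proof -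
    define t where "t = gf_f 0 + gf_g 0 + gf_h 0"
    have "2 * t = 3 * w - 1 - 2 * z ^ 2 * w"
      unfolding t_def f g h by simp
    \<comment> \<open>By \<open>sqrt_disc\<close> the target numerator is 2 - 2/w, so this is the
      claim with denominators cleared.\<close>
    then have "t * (4 * z ^ 2) * w = 2 * w - 2"
      using quad by algebra
    then have "t = (1 - z ^ 2 - sqrt_disc) / (4 * z ^ 2)"
      unfolding sqrt_disc using w0 by (simp add: field_simps)
    then show ?thesis
      by (simp only: t_def)
  qed
  show ?thesis
    using f' g' h' \<mu>2 total sum' zero by blast
qed

end
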